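(* Let $n\ge2$ and $\lambda\in\mathbb R$, and let $K_n(\lambda)=(\lambda^{|i-j|})_{i,j=1}^n$ be the Kac–Murdock–Szegő matrix (with $\lambda^0=1$). For any Hartley-type algebra $\mathcal H$ (i.e. any of the eight sets $\mathcal H_1,\dots,\mathcal H_8$ of $n\times n$ matrices defined in the context) there exist $H\in\mathcal H$ and $R\in\mathbb C^{n\times n}$ of rank two such that $K_n(\lambda)=H+R$.
   Context: For $\varphi\in\{1,-1\}$, $\Pi_\varphi\in\mathbb C^{n\times n}$ is the matrix with $(\Pi_\varphi)_{i,i+1}=1$ for $1\le i\le n-1$, $(\Pi_\varphi)_{n,1}=\varphi$ and all other entries zero; $\Pi=\Pi_1$. $\mathcal C_\varphi=\{p(\Pi_\varphi)\mid p\text{ a polynomial with complex coefficients}\}$, $\mathcal C=\mathcal C_1$. $J$ is the reverse identity, $J_{ij}=1$ if $i+j=n+1$ and $0$ otherwise. $\mathcal C_{\varphi}^{s}=\{C\in\mathcal C_{\varphi}\mid C^T=C\}$, $\mathcal C_{\varphi}^{sk}=\{C\in\mathcal C_{\varphi}\mid C^T=-C\}$, with $\mathcal C^s=\mathcal C_1^s$, $\mathcal C^{sk}=\mathcal C_1^{sk}$. The eight Hartley-type algebras are (each is an algebra of matrices simultaneously diagonalized by a unitary matrix): $\mathcal H_1=\mathcal C^s+J\Pi\,\mathcal C^{sk}$, $\mathcal H_2=\mathcal C_{-1}^s+J\Pi_{-1}\mathcal C_{-1}^{sk}$, $\mathcal H_3=\mathcal C_{-1}^s+J\mathcal C_{-1}^{sk}$,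 $\mathcal H_4=\mathcal C^s+J\mathcal C^{sk}$, $\mathcal H_5=\mathcal C^s+J\mathcal C^{s}$, $\mathcal H_6=\mathcal C_{-1}^s+J\mathcal C_{-1}^{s}$, $\mathcal H_7=\mathcal C^s+J\Pi\,\mathcal C^{s}$, $\mathcal H_8=\mathcal C_{-1}^s+J\Pi_{-1}\mathcal C_{-1}^{s}$. *)

theory Defs
  imports "Jordan_Normal_Form.DL_Rank" Complex_Main
begin

text \<open>Matrices are those of \<^theory>\<open>Jordan_Normal_Form.Matrix\<close>, so rows and columns are indexed by
  \<open>0, \<dots>, n - 1\<close>; every index formula below is shifted accordingly.\<close>

definition cyc_shift :: "nat \<Rightarrow> complex \<Rightarrow> complex mat" where
  "cyc_shift n \<phi> =
     mat n n (\<lambda>(i, j). if j = i + 1 then 1 else if i = n - 1 \<and> j = 0 then \<phi> else 0)"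

definition rev_id :: "nat \<Rightarrow> complex mat" where
  "rev_id n = mat n n (\<lambda>(i, j). if i + j = n - 1 then 1 else 0)"

text \<open>The value \<open>p(A) = \<Sum>k. coeff p k \<cdot> A\<^sup>k\<close> of a polynomial at an \<open>n \<times> n\<close> matrix, summed
  entrywise since the matrix type, having no fixed dimension, has no additive monoid structure.\<close>
definition poly_at_mat :: "nat \<Rightarrow> complex poly \<Rightarrow> complex mat \<Rightarrow> complex mat" where
  "poly_at_mat n p A =
     mat n n (\<lambda>(i, j). \<Sum>k\<le>degree p. coeff p k * (A ^\<^sub>m k) $$ (i, j))"

definition circ :: "nat \<Rightarrow> complex \<Rightarrow> complex mat set" where
  "circ n \<phi> = {poly_at_mat n p (cyc_shift n \<phi>) | p. True}"

definition circ_sym :: "nat \<Rightarrow> complex \<Rightarrow> complex mat set" where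
  "circ_sym n \<phi> = {C \<in> circ n \<phi>. transpose_mat C = C}"

definition circ_skew :: "nat \<Rightarrow> complex \<Rightarrow> complex mat set" where
  "circ_skew n \<phi> = {C \<in> circ n \<phi>. transpose_mat C = - C}"

definition hartley1 :: "nat \<Rightarrow> complex mat set" where
  "hartley1 n = {A + rev_id n * cyc_shift n 1 * B | A B. A \<in> circ_sym n 1 \<and> B \<in> circ_skew n 1}"

definition hartley2 :: "nat \<Rightarrow> complex mat set" where
  "hartley2 n =
     {A + rev_id n * cyc_shift n (-1) * B | A B. A \<in> circ_sym n (-1) \<and> B \<in> circ_skew n (-1)}"

definition hartley3 :: "nat \<Rightarrow> complex mat set" where
  "hartley3 n = {A + rev_id n * B | A B. A \<in> circ_sym n (-1) \<and> B \<in> circ_skew n (-1)}"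

definition hartley4 :: "nat \<Rightarrow> complex mat set" where
  "hartley4 n = {A + rev_id n * B | A B. A \<in> circ_sym n 1 \<and> B \<in> circ_skew n 1}"

definition hartley5 :: "nat \<Rightarrow> complex mat set" where
  "hartley5 n = {A + rev_id n * B | A B. A \<in> circ_sym n 1 \<and> B \<in> circ_sym n 1}"

definition hartley6 :: "nat \<Rightarrow> complex mat set" where
  "hartley6 n = {A + rev_id n * B | A B. A \<in> circ_sym n (-1) \<and> B \<in> circ_sym n (-1)}"

definition hartley7 :: "nat \<Rightarrow> complex mat set" where
  "hartley7 n = {A + rev_id n * cyc_shift n 1 * B | A B. A \<in> circ_sym n 1 \<and> B \<in> circ_sym n 1}"

definition hartley8 :: "nat \<Rightarrow> complex mat set" where
  "hartley8 n =
     {A + rev_id n * cyc_shift n (-1) * B | A B. A \<in> circ_sym n (-1) \<and> B \<in> circ_sym n (-1)}"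

definition hartley_algebras :: "nat \<Rightarrow> complex mat set set" where
  "hartley_algebras n =
     {hartley1 n, hartley2 n, hartley3 n, hartley4 n,
      hartley5 n, hartley6 n, hartley7 n, hartley8 n}"

definition kms_mat :: "nat \<Rightarrow> real \<Rightarrow> complex mat" where
  "kms_mat n l = mat n n (\<lambda>(i, j). complex_of_real (l ^ nat \<bar>int i - int j\<bar>))"

end

theory Submission
  imports Defs "Jordan_Normal_Form.DL_Rank_Submatrix"
begin

text \<open>For \<open>\<bar>\<lambda>\<bar> \<notin> {0, 1}\<close> the symmetric circulant part alone suffices: with
  \<open>\<alpha> = 1 / (1 - \<phi> \<lambda>\<^sup>n)\<close>, the matrix with entries \<open>\<alpha> (\<lambda>\<^sup>d + \<phi> \<lambda>\<^bsup>n-d\<^esup>)\<close>, \<open>d = \<bar>i - j\<bar>\<close>, is a symmetric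
  \<open>\<phi>\<close>-circulant, and this choice of \<open>\<alpha>\<close> makes its difference from \<open>K\<close> a multiple of
  \<open>\<lambda>\<^bsup>i-j\<^esup> + \<lambda>\<^bsup>j-i\<^esup>\<close>, which has rank two.  For \<open>\<lambda> = 0\<close> and \<open>n \<ge> 3\<close> take \<open>R = (cos (i - j)\<theta>)\<close> with
  \<open>exp (\<i> n \<theta>) = \<phi>\<close>.  For \<open>\<bar>\<lambda>\<bar> = 1\<close> the matrix \<open>K\<close> has rank one, and every Hartley-type algebra
  contains a rank-one matrix \<open>2 cos (i\<theta> - \<beta>) cos (j\<theta> - \<beta>)\<close> that is not proportional to it;
  subtract it.  For \<open>n = 2\<close> a scalar matrix that avoids the spectrum of \<open>K\<close> works.\<close>

section \<open>Certifying rank two\<close>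

text \<open>A singular \<open>A\<close> kills some nonzero \<open>v\<close>; combining the two row
  equations with the coefficients of the adjugate isolates the determinant times each entry of
  \<open>v\<close>.\<close>

lemma det_two_by_two_nonzero:
  fixes A :: "'a :: field mat"
  assumes A: "A \<in> carrier_mat 2 2"
    and nz: "A $$ (0,0) * A $$ (1,1) - A $$ (0,1) * A $$ (1,0) \<noteq> 0"
  shows "det A \<noteq> 0"
proof
  assume "det A = 0"
  then obtain v where v: "v \<in> carrier_vec 2" "v \<noteq> 0\<^sub>v 2" "A *\<^sub>v v = 0\<^sub>v 2"
    using det_0_iff_vec_prod_zero_field[OF A] by auto
  have eq: "A $$ (i,0) * v $ 0 + A $$ (i,1) * v $ 1 = 0" if "i < 2" for i
  proof -
    have "(A *\<^sub>v v) $ i = 0" using v(3) that by simp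
    then show ?thesis using A v(1) that
      by (simp add: scalar_prod_def numeral_2_eq_2)
  qed
  let ?d = "A $$ (0,0) * A $$ (1,1) - A $$ (0,1) * A $$ (1,0)"
  have e: "A $$ (0,0) * v $ 0 + A $$ (0,1) * v $ 1 = 0"
    "A $$ (1,0) * v $ 0 + A $$ (1,1) * v $ 1 = 0" using eq[of 0] eq[of 1] by simp_all
  have "?d * v $ 0 = A $$ (1,1) * (A $$ (0,0) * v $ 0 + A $$ (0,1) * v $ 1)
      - A $$ (0,1) * (A $$ (1,0) * v $ 0 + A $$ (1,1) * v $ 1)"
    by (simp add: algebra_simps)
  then have "v $ 0 = 0" using e nz by simp
  moreover have "?d * v $ 1 = A $$ (0,0) * (A $$ (1,0) * v $ 0 + A $$ (1,1) * v $ 1)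
      - A $$ (1,0) * (A $$ (0,0) * v $ 0 + A $$ (0,1) * v $ 1)"
    by (simp add: algebra_simps)
  then have "v $ 1 = 0" using e nz by simp
  ultimately have "v = 0\<^sub>v 2" using v(1)
    by (intro eq_vecI) (auto simp: less_2_cases_iff)
  with v(2) show False ..
qed

text \<open>Two outer products bound the rank from above. From below, the minor on rows and columns
  \<open>r\<close>, \<open>s\<close> factors by Cauchy-Binet into the two determinants assumed
  nonzero.\<close>

lemma rank_eq_2I:
  fixes R :: "'a :: field mat"
  assumes R: "R \<in> carrier_mat n n"
    and entries: "\<And>i j. i < n \<Longrightarrow> j < n \<Longrightarrow> R $$ (i,j) = a i * p j + b i * q j"
    and rs: "r < s" "s < n"
    and ab: "a r * b s - a s * b r \<noteq> 0" and pq: "p r * q s - p s * q r \<noteq> 0"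
  shows "vec_space.rank n R = 2"
proof (rule antisym)
  interpret vec_space "TYPE('a)" n .
  let ?A = "mat n n (\<lambda>(i,j). a i * p j)" and ?B = "mat n n (\<lambda>(i,j). b i * q j)"
  have "rank ?A \<le> 1" by (rule rank_le_1_product_entries[of _ n a p]) auto
  moreover have "rank ?B \<le> 1" by (rule rank_le_1_product_entries[of _ n b q]) auto
  moreover have "R = ?A + ?B" using R entries by (intro eq_matI) auto
  ultimately show "rank R \<le> 2"
    using rank_subadditive[of ?A n ?B] by auto
  let ?I = "{r, s}"
  let ?S = "submatrix R ?I ?I"
  have set_I: "{i. i < n \<and> i \<in> ?I} = ?I" using rs by auto
  have dims: "dim_row R = n" "dim_col R = n" using R by auto
  have S: "?S \<in> carrier_mat 2 2"
    by (rule carrier_matI, unfold dim_submatrix dims set_I) (use rs in simp_all)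
  \<comment> \<open>\<open>submatrix\<close> renumbers a selected index by the number of selected
    ones below it, so \<open>r\<close> becomes 0 and \<open>s\<close> becomes 1.\<close>
  have "{x \<in> ?I. x < r} = {}" "{x \<in> ?I. x < s} = {r}" using rs by auto
  then have c: "card {x \<in> ?I. x < r} = 0" "card {x \<in> ?I. x < s} = 1" by simp_all
  have idx: "?S $$ (card {x \<in> ?I. x < i}, card {x \<in> ?I. x < j}) = a i * p j + b i * q j"
    if "i \<in> ?I" "j \<in> ?I" for i j
    using submatrix_index_card[of i R j ?I ?I] that rs R entries[of i j] by auto
  have "det ?S \<noteq> 0"
  proof (rule det_two_by_two_nonzero[OF S])
    have "?S $$ (0,0) * ?S $$ (1,1) - ?S $$ (0,1) * ?S $$ (1,0)
        = (a r * b s - a s * b r) * (p r * q s - p s * q r)"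
      using idx[of r r] idx[of s s] idx[of r s] idx[of s r]
      unfolding c by (simp add: algebra_simps)
    then show "?S $$ (0,0) * ?S $$ (1,1) - ?S $$ (0,1) * ?S $$ (1,0) \<noteq> 0"
      using ab pq by simp
  qed
  from rank_gt_minor[OF R this] show "2 \<le> rank R"
    unfolding set_I using rs by simp
qed

section \<open>Toeplitz matrices, the shift and the reversal\<close>

text \<open>The symbol lives on all of \<open>int\<close>, so that symmetry and the periodicity of a
  circulant become equations on \<open>c\<close>.\<close>

definition toep :: "nat \<Rightarrow> (int \<Rightarrow> complex) \<Rightarrow> complex mat" where
  "toep n c = mat n n (\<lambda>(i, j). c (int i - int j))"

lemma toep_carrier [simp]: "toep n c \<in> carrier_mat n n"
  and toep_dim [simp]: "dim_row (toep n c) = n" "dim_col (toep n c) = n"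
  by (simp_all add: toep_def)

lemma toep_index [simp]: "i < n \<Longrightarrow> j < n \<Longrightarrow> toep n c $$ (i, j) = c (int i - int j)"
  by (simp add: toep_def)

lemma cyc_shift_carrier [simp]: "cyc_shift n \<phi> \<in> carrier_mat n n"
  and rev_id_carrier [simp]: "rev_id n \<in> carrier_mat n n"
  by (simp_all add: cyc_shift_def rev_id_def)

lemma cyc_shift_mult_index:
  assumes M: "M \<in> carrier_mat n m" and ij: "i < n" "j < m"
  shows "(cyc_shift n \<phi> * M) $$ (i, j) = (if i + 1 < n then M $$ (i + 1, j) else \<phi> * M $$ (0, j))"
proof -
  have "(cyc_shift n \<phi> * M) $$ (i, j)
      = (\<Sum>k<n. (if k = i + 1 then 1 else if i = n - 1 \<and> k = 0 then \<phi> else 0) * M $$ (k, j))"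
    using M ij by (simp add: cyc_shift_def scalar_prod_def lessThan_atLeast0)
  also have "\<dots> = (\<Sum>k<n. if k = (if i + 1 < n then i + 1 else 0)
      then (if i + 1 < n then M $$ (i + 1, j) else \<phi> * M $$ (0, j)) else 0)"
    using ij by (intro sum.cong) auto
  also have "\<dots> = (if i + 1 < n then M $$ (i + 1, j) else \<phi> * M $$ (0, j))"
    using ij by (subst sum.delta) auto
  finally show ?thesis .
qed

lemma rev_id_mult_index:
  assumes M: "M \<in> carrier_mat n m" and ij: "i < n" "j < m"
  shows "(rev_id n * M) $$ (i, j) = M $$ (n - 1 - i, j)"
proof -
  have "(rev_id n * M) $$ (i, j) = (\<Sum>k<n. (if i + k = n - 1 then 1 else 0) * M $$ (k, j))"
    using M ij by (simp add: rev_id_def scalar_prod_def lessThan_atLeast0)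
  also have "\<dots> = (\<Sum>k<n. if k = n - 1 - i then M $$ (k, j) else 0)"
    using ij by (intro sum.cong) auto
  also have "\<dots> = M $$ (n - 1 - i, j)"
    using ij by (subst sum.delta) auto
  finally show ?thesis .
qed

section \<open>Circulants and their reversals\<close>

lemma pow_mat_Suc_left:
  assumes "A \<in> carrier_mat n n"
  shows "A ^\<^sub>m Suc k = A * A ^\<^sub>m k"
proof (induction k)
  case (Suc k)
  have "A ^\<^sub>m Suc (Suc k) = (A * A ^\<^sub>m k) * A" using Suc by simp
  also have "\<dots> = A * (A ^\<^sub>m k * A)"
    using assms by (intro assoc_mult_mat[of _ n n _ n _ n]) simp_all
  finally show ?case by simp
qed (use assms in simp)

text \<open>For \<open>k < n\<close> a row wraps around at most once, so \<open>\<phi>\<close>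
  enters at most to the first power.\<close>

lemma cyc_shift_pow_index:
  assumes "k < n" "i < n" "j < n"
  shows "(cyc_shift n \<phi> ^\<^sub>m k) $$ (i, j)
    = (if j = i + k then 1 else if j + n = i + k then \<phi> else 0)"
  using assms
proof (induction k arbitrary: i)
  case 0
  then show ?case by (simp add: cyc_shift_def)
next
  case (Suc k)
  have "(cyc_shift n \<phi> ^\<^sub>m Suc k) $$ (i, j)
      = (if i + 1 < n then (cyc_shift n \<phi> ^\<^sub>m k) $$ (i + 1, j)
         else \<phi> * (cyc_shift n \<phi> ^\<^sub>m k) $$ (0, j))"
    using Suc.prems unfolding pow_mat_Suc_left[OF cyc_shift_carrier]
    by (simp add: cyc_shift_mult_index[where m = n])
  then show ?case
    using Suc.prems Suc.IH[of "i + 1"] Suc.IH[of 0] by auto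
qed

text \<open>The periodicity is required only at offsets that occur in the matrix, so that
  \<open>c\<close> may be a function of \<open>\<bar>k\<bar>\<close> that is not periodic on all integers.\<close>
lemma toep_in_circ:
  assumes per: "\<And>k. - int n < k \<Longrightarrow> k < 0 \<Longrightarrow> c (k + int n) = \<phi> * c k"
  shows "toep n c \<in> circ n \<phi>"
proof -
  \<comment> \<open>The \<open>k\<close>-th power of the shift has its ones at
    \<open>i - j = -k\<close>, hence the coefficient \<open>c (- int k)\<close>; its entries
    \<open>\<phi>\<close> at \<open>i - j = n - k\<close> then match the symbol by
    \<open>per\<close>.\<close>
  define p where "p = (\<Sum>k<n. monom (c (- int k)) k)"
  have coeff_p: "coeff p k = (if k < n then c (- int k) else 0)" for k
    by (simp add: p_def coeff_sum)
  have "toep n c = poly_at_mat n p (cyc_shift n \<phi>)"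
  proof (rule eq_matI)
    fix i j
    assume "i < dim_row (poly_at_mat n p (cyc_shift n \<phi>))"
      "j < dim_col (poly_at_mat n p (cyc_shift n \<phi>))"
    then have ij: "i < n" "j < n" by (simp_all add: poly_at_mat_def)
    let ?P = "\<lambda>k. (cyc_shift n \<phi> ^\<^sub>m k) $$ (i, j)"
    \<comment> \<open>The only exponent below \<open>n\<close> that links row \<open>i\<close> to
      column \<open>j\<close>, without or with a wraparound.\<close>
    let ?k = "if i \<le> j then j - i else j + n - i"
    have "(\<Sum>k\<le>degree p. coeff p k * ?P k) = (\<Sum>k\<le>degree p + n. coeff p k * ?P k)"
      by (rule sum.mono_neutral_left) (auto simp: coeff_eq_0)
    also have "\<dots> = (\<Sum>k<n. coeff p k * ?P k)"
      by (rule sum.mono_neutral_right) (auto simp: coeff_p)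
    also have "\<dots> = (\<Sum>k<n. if k = ?k then c (int i - int j) else 0)"
    proof (rule sum.cong)
      fix k assume "k \<in> {..<n}"
      then have k: "k < n" by simp
      consider "j = i + k" | "j + n = i + k" "j \<noteq> i + k" | "j \<noteq> i + k" "j + n \<noteq> i + k" by blast
      then show "coeff p k * ?P k = (if k = ?k then c (int i - int j) else 0)"
      proof cases
        case 2
        then have k_eq: "k = ?k" and neg: "i > j" using ij k by auto
        have "- int k = int i - int j - int n" using 2 by linarith
        then have "coeff p k = c (int i - int j - int n)" using k by (simp only: coeff_p if_True)
        moreover have "?P k = \<phi>" using 2(2) k ij by (simp add: cyc_shift_pow_index flip: 2(1))
        moreover have "c (int i - int j) = \<phi> * c (int i - int j - int n)"
          using per[of "int i - int j - int n"] ij neg by simp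
        ultimately show ?thesis unfolding if_P[OF k_eq] by simp
      qed (use k ij in \<open>auto simp: coeff_p cyc_shift_pow_index\<close>)
    qed simp
    also have "\<dots> = c (int i - int j)"
      using ij by (subst sum.delta) auto
    finally show "toep n c $$ (i, j) = poly_at_mat n p (cyc_shift n \<phi>) $$ (i, j)"
      using ij by (simp add: poly_at_mat_def)
  qed (simp_all add: poly_at_mat_def)
  then show ?thesis unfolding circ_def by blast
qed

lemma toep_in_circ_sym:
  assumes "\<And>k. - int n < k \<Longrightarrow> k < 0 \<Longrightarrow> c (k + int n) = \<phi> * c k" and "\<And>k. c (- k) = c k"
  shows "toep n c \<in> circ_sym n \<phi>"
proof -
  have "transpose_mat (toep n c) = toep n c"
    by (rule eq_matI) (simp_all, metis assms(2) minus_diff_eq)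
  then show ?thesis using toep_in_circ assms(1) by (simp add: circ_sym_def)
qed

lemma toep_in_circ_skew:
  assumes "\<And>k. - int n < k \<Longrightarrow> k < 0 \<Longrightarrow> c (k + int n) = \<phi> * c k" and "\<And>k. c (- k) = - c k"
  shows "toep n c \<in> circ_skew n \<phi>"
proof -
  have "transpose_mat (toep n c) = - toep n c"
    by (rule eq_matI) (simp_all, metis assms(2) minus_diff_eq)
  then show ?thesis using toep_in_circ assms(1) by (simp add: circ_skew_def)
qed

lemma rev_id_mult_toep:
  "rev_id n * toep n c = mat n n (\<lambda>(i, j). c (int n - 1 - int i - int j))"
proof (rule eq_matI)
  fix i j
  assume "i < dim_row (mat n n (\<lambda>(i, j). c (int n - 1 - int i - int j)))"
    "j < dim_col (mat n n (\<lambda>(i, j). c (int n - 1 - int i - int j)))"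
  then have ij: "i < n" "j < n" by simp_all
  then have "(rev_id n * toep n c) $$ (i, j) = toep n c $$ (n - 1 - i, j)"
    by (intro rev_id_mult_index) simp_all
  also have "\<dots> = c (int (n - 1 - i) - int j)" using ij by (intro toep_index) simp_all
  also have "int (n - 1 - i) - int j = int n - 1 - int i - int j" using ij by linarith
  finally show "(rev_id n * toep n c) $$ (i, j)
      = mat n n (\<lambda>(i, j). c (int n - 1 - int i - int j)) $$ (i, j)"
    using ij by simp
qed (simp_all add: rev_id_def)

text \<open>Reversal reads row \<open>n - 1 - i\<close>, which the shift takes from row
  \<open>n - i\<close>. For \<open>i = 0\<close> this wraps to row 0 with factor
  \<open>\<phi>\<close>; \<open>per\<close> absorbs it, even at offset \<open>n\<close>, which no
  entry of \<open>toep n c\<close> has.\<close>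

lemma rev_id_mult_cyc_shift_mult_toep:
  assumes per: "\<And>k. c (k + int n) = \<phi> * c k"
  shows "rev_id n * cyc_shift n \<phi> * toep n c = mat n n (\<lambda>(i, j). c (int n - int i - int j))"
    (is "?L = ?R")
proof (rule eq_matI)
  fix i j
  assume "i < dim_row ?R" "j < dim_col ?R"
  then have ij: "i < n" "j < n" by simp_all
  have P: "cyc_shift n \<phi> * toep n c \<in> carrier_mat n n"
    by (rule mult_carrier_mat[of _ n n]) simp_all
  have "?L = rev_id n * (cyc_shift n \<phi> * toep n c)"
    by (rule assoc_mult_mat[of _ n n _ n _ n]) simp_all
  then have "?L $$ (i, j) = (cyc_shift n \<phi> * toep n c) $$ (n - 1 - i, j)"
    using ij P by (simp add: rev_id_mult_index[where m = n])
  also have "\<dots> = (if i = 0 then \<phi> * c (- int j) else c (int (n - i) - int j))"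
  proof (cases "i = 0")
    case True
    then show ?thesis using ij by (subst cyc_shift_mult_index[where m = n]) auto
  next
    case False
    then have "n - 1 - i + 1 = n - i" using ij by auto
    then show ?thesis using ij False by (subst cyc_shift_mult_index[where m = n]) simp_all
  qed
  also have "\<dots> = c (int n - int i - int j)"
    using ij per[of "- int j"] by (auto simp: of_nat_diff algebra_simps)
  finally show "?L $$ (i, j) = ?R $$ (i, j)" using ij by simp
qed (simp_all add: rev_id_def toep_def)

section \<open>The eight Hartley-type algebras\<close>

text \<open>One interface for all eight: \<open>\<phi>\<close> is the kind of circulant,
  \<open>\<epsilon>\<close> the parity of the symbol \<open>d\<close> of the second summand, and
  \<open>s\<close> is \<open>n - 1\<close> for the factor \<open>rev_id n\<close> and
  \<open>n\<close> for \<open>rev_id n * cyc_shift n \<phi>\<close>. The latter factor calls for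
  \<open>d\<close> to be periodic at all integers.\<close>

lemma hartley_cases:
  assumes "\<H> \<in> hartley_algebras n"
  obtains \<phi> s \<epsilon> where "\<phi> = 1 \<or> \<phi> = -1" "\<epsilon> = 1 \<or> \<epsilon> = -1"
    "\<And>c d. \<lbrakk>\<And>k. - int n < k \<Longrightarrow> k < 0 \<Longrightarrow> c (k + int n) = \<phi> * c k; \<And>k. c (- k) = c k;
             \<And>k. d (k + int n) = \<phi> * d k; \<And>k. d (- k) = \<epsilon> * d k\<rbrakk>
        \<Longrightarrow> mat n n (\<lambda>(i, j). c (int i - int j) + d (s - int i - int j)) \<in> \<H>"
proof -
  have J: "mat n n (\<lambda>(i, j). c (int i - int j) + d (int n - 1 - int i - int j))
      \<in> {A + rev_id n * B | A B. A \<in> S \<and> B \<in> T}"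
    if "toep n c \<in> S" "toep n d \<in> T" for c d S T
  proof -
    have "mat n n (\<lambda>(i, j). c (int i - int j) + d (int n - 1 - int i - int j))
        = toep n c + rev_id n * toep n d"
      unfolding rev_id_mult_toep by (rule eq_matI) simp_all
    then show ?thesis using that by blast
  qed
  have JP: "mat n n (\<lambda>(i, j). c (int i - int j) + d (int n - int i - int j))
      \<in> {A + rev_id n * cyc_shift n \<phi> * B | A B. A \<in> S \<and> B \<in> T}"
    if "toep n c \<in> S" "toep n d \<in> T" "\<And>k. d (k + int n) = \<phi> * d k" for c d S T \<phi>
  proof -
    have "mat n n (\<lambda>(i, j). c (int i - int j) + d (int n - int i - int j))
        = toep n c + rev_id n * cyc_shift n \<phi> * toep n d"
      unfolding rev_id_mult_cyc_shift_mult_toep[of d n \<phi>, OF that(3)] by (rule eq_matI) simp_all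
    then show ?thesis using that by blast
  qed
  from assms consider "\<H> = hartley1 n" | "\<H> = hartley2 n" | "\<H> = hartley3 n" | "\<H> = hartley4 n"
    | "\<H> = hartley5 n" | "\<H> = hartley6 n" | "\<H> = hartley7 n" | "\<H> = hartley8 n"
    unfolding hartley_algebras_def by blast
  then show ?thesis
  proof cases
    case 1
    show ?thesis
      by (rule that[of "1" "-1" "int n"], unfold 1 hartley1_def)
        (rule JP toep_in_circ_sym toep_in_circ_skew | simp)+
  next
    case 2
    show ?thesis
      by (rule that[of "-1" "-1" "int n"], unfold 2 hartley2_def)
        (rule JP toep_in_circ_sym toep_in_circ_skew | simp)+
  next
    case 3
    show ?thesis
      by (rule that[of "-1" "-1" "int n - 1"], unfold 3 hartley3_def)
        (rule J toep_in_circ_sym toep_in_circ_skew | simp)+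
  next
    case 4
    show ?thesis
      by (rule that[of "1" "-1" "int n - 1"], unfold 4 hartley4_def)
        (rule J toep_in_circ_sym toep_in_circ_skew | simp)+
  next
    case 5
    show ?thesis
      by (rule that[of "1" "1" "int n - 1"], unfold 5 hartley5_def)
        (rule J toep_in_circ_sym toep_in_circ_skew | simp)+
  next
    case 6
    show ?thesis
      by (rule that[of "-1" "1" "int n - 1"], unfold 6 hartley6_def)
        (rule J toep_in_circ_sym toep_in_circ_skew | simp)+
  next
    case 7
    show ?thesis
      by (rule that[of "1" "1" "int n"], unfold 7 hartley7_def)
        (rule JP toep_in_circ_sym toep_in_circ_skew | simp)+
  next
    case 8
    show ?thesis
      by (rule that[of "-1" "1" "int n"], unfold 8 hartley8_def)
        (rule JP toep_in_circ_sym toep_in_circ_skew | simp)+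
  qed
qed

text \<open>The rank-one element comes from
  \<open>2 cos (i\<theta> - \<beta>) cos (j\<theta> - \<beta>) = cos (i - j)\<theta> + cos (s\<theta> - (i + j)\<theta> - \<gamma>)\<close> with \<open>2\<beta> = s\<theta> - \<gamma>\<close>, where
  \<open>\<gamma>\<close> is \<open>0\<close> or \<open>\<pi>/2\<close> according to whether the second summand of the algebra is symmetric or
  skew-symmetric.\<close>
lemma hartley_toep_and_cos:
  assumes "\<H> \<in> hartley_algebras n"
  obtains \<phi> :: real where "\<phi> = 1 \<or> \<phi> = -1"
    "\<And>c. \<lbrakk>\<And>k. - int n < k \<Longrightarrow> k < 0 \<Longrightarrow> c (k + int n) = of_real \<phi> * c k; \<And>k. c (- k) = c k\<rbrakk>
        \<Longrightarrow> toep n c \<in> \<H>"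
    "\<And>\<theta>. cos (n * \<theta>) = \<phi> \<Longrightarrow> \<exists>\<beta>.
        mat n n (\<lambda>(i, j). complex_of_real (2 * cos (real i * \<theta> - \<beta>) * cos (real j * \<theta> - \<beta>))) \<in> \<H>"
proof (rule hartley_cases[OF assms])
  fix \<phi> \<epsilon> :: complex and s
  assume \<phi>: "\<phi> = 1 \<or> \<phi> = -1" and \<epsilon>: "\<epsilon> = 1 \<or> \<epsilon> = -1" and
    mem: "\<And>c d. \<lbrakk>\<And>k. - int n < k \<Longrightarrow> k < 0 \<Longrightarrow> c (k + int n) = \<phi> * c k; \<And>k. c (- k) = c k;
             \<And>k. d (k + int n) = \<phi> * d k; \<And>k. d (- k) = \<epsilon> * d k\<rbrakk>
        \<Longrightarrow> mat n n (\<lambda>(i, j). c (int i - int j) + d (s - int i - int j)) \<in> \<H>"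
  have \<phi>': "\<phi> = of_real (Re \<phi>)" "Re \<phi> = 1 \<or> Re \<phi> = -1" using \<phi> by auto
  show ?thesis
  proof (rule that[of "Re \<phi>"])
    show "Re \<phi> = 1 \<or> Re \<phi> = -1" by (rule \<phi>'(2))
    fix c :: "int \<Rightarrow> complex"
    assume "\<And>k. - int n < k \<Longrightarrow> k < 0 \<Longrightarrow> c (k + int n) = of_real (Re \<phi>) * c k"
      and "\<And>k. c (- k) = c k"
    then have "mat n n (\<lambda>(i, j). c (int i - int j) + 0) \<in> \<H>"
      using mem[of c "\<lambda>_. 0"] \<phi>'(1) by simp
    then show "toep n c \<in> \<H>" by (simp add: toep_def)
  next
    fix \<theta> :: real
    assume cos_n: "cos (n * \<theta>) = Re \<phi>"
    have sin_n: "sin (n * \<theta>) = 0"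
      using sin_cos_squared_add[of "n * \<theta>"] cos_n \<phi>'(2) by auto
    define \<gamma> :: real where "\<gamma> = (if \<epsilon> = 1 then 0 else pi / 2)"
    define \<beta> where "\<beta> = (s * \<theta> - \<gamma>) / 2"
    have per: "cos (of_int (k + int n) * \<theta> - \<delta>) = Re \<phi> * cos (of_int k * \<theta> - \<delta>)" for k \<delta>
    proof -
      have "of_int (k + int n) * \<theta> - \<delta> = (of_int k * \<theta> - \<delta>) + n * \<theta>" by (simp add: algebra_simps)
      then show ?thesis by (simp only: cos_add cos_n sin_n) simp
    qed
    have "mat n n (\<lambda>(i, j). complex_of_real (cos (of_int (int i - int j) * \<theta> - 0))
        + complex_of_real (cos (of_int (s - int i - int j) * \<theta> - \<gamma>))) \<in> \<H>"
    proof (rule mem)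
      fix k
      show "complex_of_real (cos (of_int (k + int n) * \<theta> - 0))
          = \<phi> * complex_of_real (cos (of_int k * \<theta> - 0))"
        by (subst \<phi>'(1), subst per) simp
      show "complex_of_real (cos (of_int (k + int n) * \<theta> - \<gamma>))
          = \<phi> * complex_of_real (cos (of_int k * \<theta> - \<gamma>))"
        by (subst \<phi>'(1), subst per) simp
      show "complex_of_real (cos (of_int (- k) * \<theta> - 0)) = complex_of_real (cos (of_int k * \<theta> - 0))"
        by simp
      show "complex_of_real (cos (of_int (- k) * \<theta> - \<gamma>))
          = \<epsilon> * complex_of_real (cos (of_int k * \<theta> - \<gamma>))"
        using \<epsilon> by (auto simp: \<gamma>_def cos_diff)
    qed
    also have "mat n n (\<lambda>(i, j). complex_of_real (cos (of_int (int i - int j) * \<theta> - 0))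
        + complex_of_real (cos (of_int (s - int i - int j) * \<theta> - \<gamma>)))
      = mat n n (\<lambda>(i, j). complex_of_real (2 * cos (real i * \<theta> - \<beta>) * cos (real j * \<theta> - \<beta>)))"
    proof (rule eq_matI, goal_cases)
      case (1 i j)
      then have ij: "i < n" "j < n" by simp_all
      have "2 * cos (real i * \<theta> - \<beta>) * cos (real j * \<theta> - \<beta>)
          = cos ((real i * \<theta> - \<beta>) - (real j * \<theta> - \<beta>)) + cos ((real i * \<theta> - \<beta>) + (real j * \<theta> - \<beta>))"
        unfolding cos_add[of "real i * \<theta> - \<beta>" "real j * \<theta> - \<beta>"]
          cos_diff[of "real i * \<theta> - \<beta>" "real j * \<theta> - \<beta>"] by simp
      also have "(real i * \<theta> - \<beta>) - (real j * \<theta> - \<beta>) = of_int (int i - int j) * \<theta> - 0"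
        by (simp add: algebra_simps)
      also have "(real i * \<theta> - \<beta>) + (real j * \<theta> - \<beta>) = - (of_int (s - int i - int j) * \<theta> - \<gamma>)"
        by (simp add: \<beta>_def algebra_simps)
      finally show ?case using ij by (simp only: cos_minus index_mat case_prod_conv of_real_add)
    qed simp_all
    finally show "\<exists>\<beta>. mat n n (\<lambda>(i, j).
        complex_of_real (2 * cos (real i * \<theta> - \<beta>) * cos (real j * \<theta> - \<beta>))) \<in> \<H>" by blast
  qed
qed

section \<open>Independence when \<open>l\<close> has modulus one\<close>

text \<open>The cosines obey \<open>w 2 + w 0 = 2 * cos \<theta> * w 1\<close>. Proportionality to
  the powers of \<open>l\<close> on 0, 1, 2 would give \<open>w 0 = l * cos \<theta> * w 0\<close>,
  so \<open>w 0 = w 1 = 0\<close> because \<open>\<bar>cos \<theta>\<bar> < 1\<close>; yet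
  \<open>cos \<beta>\<close> and \<open>cos (\<theta> - \<beta>)\<close> cannot both vanish when
  \<open>sin \<theta> \<noteq> 0\<close>.\<close>

lemma cos_shift_not_proportional_to_power:
  fixes l \<theta> \<beta> :: real
  assumes l: "\<bar>l\<bar> = 1" and \<theta>: "sin \<theta> \<noteq> 0"
  defines "w \<equiv> \<lambda>i::nat. cos (real i * \<theta> - \<beta>)"
  shows "\<exists>r s. r < s \<and> s < 3 \<and> l ^ r * w s - l ^ s * w r \<noteq> 0"
proof (rule ccontr)
  assume "\<not> ?thesis"
  then have "l ^ r * w s - l ^ s * w r = 0" if "r < s" "s < 3" for r s using that by blast
  from this[of 0 1] this[of 0 2] have w: "w 1 = l * w 0" "w 2 = l\<^sup>2 * w 0" by simp_all
  have "w 2 + w 0 = 2 * cos \<theta> * w 1"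
  proof -
    have "w 2 = cos ((\<theta> - \<beta>) + \<theta>)" "w 0 = cos ((\<theta> - \<beta>) - \<theta>)" "w 1 = cos (\<theta> - \<beta>)"
      by (simp_all add: w_def algebra_simps)
    then show ?thesis by (simp only: cos_add cos_diff[of "\<theta> - \<beta>" \<theta>]) simp
  qed
  moreover have l2: "l * l = 1" using l by (metis abs_mult_self_eq mult_1)
  ultimately have "w 0 * (1 - l * cos \<theta>) = 0" using w by (simp add: power2_eq_square algebra_simps)
  moreover have "1 - l * cos \<theta> \<noteq> 0"
  proof
    assume "1 - l * cos \<theta> = 0"
    then have "(l * cos \<theta>)\<^sup>2 = 1" by simp
    moreover have "l\<^sup>2 = 1" using l2 by (simp add: power2_eq_square)
    ultimately have "(cos \<theta>)\<^sup>2 = 1" by (simp add: power_mult_distrib)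
    with \<theta> show False using sin_cos_squared_add[of \<theta>] by simp
  qed
  ultimately have w0: "w 0 = 0" by simp
  then have "cos \<beta> = 0" "cos (\<theta> - \<beta>) = 0" using w(1) by (simp_all add: w_def)
  then have "sin \<beta> = 0" using \<theta> by (simp add: cos_diff)
  with \<open>cos \<beta> = 0\<close> show False using sin_cos_squared_add[of \<beta>] by simp
qed

section \<open>The case distinction on \<open>n\<close> and \<open>l\<close>\<close>

theorem lemma5p9:
  fixes n :: nat and l :: real and \<H> :: "complex mat set"
  assumes "n \<ge> 2" and "\<H> \<in> hartley_algebras n"
  shows "\<exists>H \<in> \<H>. \<exists>R \<in> carrier_mat n n. vec_space.rank n R = 2 \<and> kms_mat n l = H + R"
proof (rule hartley_toep_and_cos[OF assms(2)])
  fix \<phi> :: real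
  assume \<phi>: "\<phi> = 1 \<or> \<phi> = -1" and
    toep: "\<And>c. \<lbrakk>\<And>k. - int n < k \<Longrightarrow> k < 0 \<Longrightarrow> c (k + int n) = of_real \<phi> * c k; \<And>k. c (- k) = c k\<rbrakk>
        \<Longrightarrow> toep n c \<in> \<H>" and
    rank_one: "\<And>\<theta>::real. cos (n * \<theta>) = \<phi> \<Longrightarrow> \<exists>\<beta>.
        mat n n (\<lambda>(i, j). complex_of_real (2 * cos (real i * \<theta> - \<beta>) * cos (real j * \<theta> - \<beta>))) \<in> \<H>"
  \<comment> \<open>\<open>2 * pi / n\<close> serves \<open>\<phi> = 1\<close> and
    \<open>pi / n\<close> serves \<open>\<phi> = -1\<close>; \<open>n \<ge> 3\<close> puts both
    strictly between 0 and \<open>pi\<close>.\<close>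
  have angle: "\<exists>\<theta>::real. cos (n * \<theta>) = \<phi> \<and> sin (n * \<theta>) = 0 \<and> sin \<theta> \<noteq> 0" if "n \<ge> 3"
  proof -
    have "2 * pi / n < pi" "pi / n < pi" using that by (simp_all add: field_simps)
    then have "sin (2 * pi / n) > 0" "sin (pi / n) > 0" using that by (auto intro!: sin_gt_zero)
    moreover have "n * (2 * pi / n) = 2 * pi" "n * (pi / n) = pi" using that by simp_all
    ultimately show ?thesis
      using \<phi> by (metis cos_pi cos_two_pi less_irrefl sin_pi sin_two_pi)
  qed
  \<comment> \<open>Each case now only has to supply a member \<open>h\<close> of the algebra whose
    difference from K splits into two outer products meeting \<open>rank_eq_2I\<close>.\<close>
  have witness: ?thesis
    if "mat n n (\<lambda>(i, j). h i j) \<in> \<H>"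
      and "\<And>i j. i < n \<Longrightarrow> j < n \<Longrightarrow>
        complex_of_real (l ^ nat \<bar>int i - int j\<bar>) - h i j = a i * p j + b i * q j"
      and "r < s" "s < n" "a r * b s - a s * b r \<noteq> 0" "p r * q s - p s * q r \<noteq> 0"
    for h :: "nat \<Rightarrow> nat \<Rightarrow> complex" and a b p q r s
  proof (intro bexI conjI)
    let ?H = "mat n n (\<lambda>(i, j). h i j)"
    let ?R = "mat n n (\<lambda>(i, j). a i * p j + b i * q j)"
    show "?H \<in> \<H>" "?R \<in> carrier_mat n n" using that(1) by simp_all
    show "vec_space.rank n ?R = 2"
      by (rule rank_eq_2I[of _ _ a p b q r s]) (use that in simp_all)
    show "kms_mat n l = ?H + ?R"
      by (rule eq_matI) (simp_all add: kms_mat_def that(2)[symmetric])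
  qed
  \<comment> \<open>\<open>n = 2\<close> stands apart: for \<open>\<phi> = 1\<close>,
    \<open>cos (2 * \<theta>) = 1\<close> forces \<open>sin \<theta> = 0\<close>, so no suitable
    angle exists.\<close>
  consider "n = 2" | "n \<ge> 3" "l \<noteq> 0" "\<bar>l\<bar> \<noteq> 1" | "n \<ge> 3" "l = 0" | "n \<ge> 3" "\<bar>l\<bar> = 1"
    using assms(1) by linarith
  then show ?thesis
  proof cases
    case 1
    \<comment> \<open>Vanishing off the diagonal suits either \<open>\<phi>\<close>, and
      \<open>\<bar>l\<bar> + 2\<close> exceeds both eigenvalues \<open>1 + l\<close> and
      \<open>1 - l\<close> of K.\<close>
    define c :: "int \<Rightarrow> complex" where "c = (\<lambda>k. if k = 0 then of_real (\<bar>l\<bar> + 2) else 0)"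
    let ?e = "complex_of_real (1 - (\<bar>l\<bar> + 2))"
    have "toep n c \<in> \<H>" by (rule toep) (auto simp: c_def)
    then show ?thesis unfolding toep_def
    proof (rule witness)
      show "(0::nat) < 1" "1 < n" using 1 by simp_all
      fix i j assume "i < n" "j < n"
      then show "complex_of_real (l ^ nat \<bar>int i - int j\<bar>) - c (int i - int j)
          = (if i = 0 then 1 else 0) * (if j = 0 then ?e else of_real l)
            + (if i = 1 then 1 else 0) * (if j = 1 then ?e else of_real l)"
        using 1 by (auto simp: c_def less_2_cases_iff)
    next
      have "\<bar>l\<bar> * \<bar>l\<bar> < (\<bar>l\<bar> + 1) * (\<bar>l\<bar> + 1)" by (intro mult_strict_mono) auto
      then have "(1 - (\<bar>l\<bar> + 2)) * (1 - (\<bar>l\<bar> + 2)) - l * l \<noteq> 0" by (simp add: algebra_simps)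
      then have "complex_of_real ((1 - (\<bar>l\<bar> + 2)) * (1 - (\<bar>l\<bar> + 2)) - l * l) \<noteq> 0"
        unfolding of_real_eq_0_iff .
      then show "(if (0::nat) = 0 then ?e else of_real l) * (if (1::nat) = 1 then ?e else of_real l)
          - (if (1::nat) = 0 then ?e else of_real l) * (if (0::nat) = 1 then ?e else of_real l) \<noteq> 0"
        by simp
    qed simp
  next
    case 2
    have ln: "1 - \<phi> * l ^ n \<noteq> 0"
    proof
      assume "1 - \<phi> * l ^ n = 0"
      then have "\<bar>l\<bar> ^ n = 1" using \<phi> by (auto simp: power_abs[symmetric])
      then show False using 2 power_eq_iff_eq_base[of n "\<bar>l\<bar>" 1] by simp
    qed
    define \<alpha> where "\<alpha> = 1 / (1 - \<phi> * l ^ n)"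
    \<comment> \<open>As \<open>l ^ (n - d) = l ^ n * inverse l ^ d\<close>, this is the coefficient
      of \<open>inverse l ^ d\<close> in the difference; \<open>\<alpha>\<close> makes it equal to
      \<open>1 - \<alpha>\<close>, the coefficient of \<open>l ^ d\<close>.\<close>
    define \<kappa> where "\<kappa> = - \<alpha> * \<phi> * l ^ n"
    have \<alpha>: "1 - \<alpha> = \<kappa>" using ln by (simp add: \<alpha>_def \<kappa>_def field_simps)
    have "\<kappa> \<noteq> 0" using ln \<phi> 2 by (auto simp: \<alpha>_def \<kappa>_def)
    define c :: "int \<Rightarrow> complex"
      where "c = (\<lambda>k. of_real (\<alpha> * (l ^ nat \<bar>k\<bar> + \<phi> * l ^ (n - nat \<bar>k\<bar>))))"
    have "toep n c \<in> \<H>"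
    proof (rule toep)
      \<comment> \<open>Passing from \<open>k\<close> to \<open>k + n\<close> exchanges the two
        exponents, which amounts to a factor \<open>\<phi>\<close> since
        \<open>\<phi> * \<phi> = 1\<close>.\<close>
      fix k :: int assume k: "- int n < k" "k < 0"
      then have "nat \<bar>k + int n\<bar> = n - nat \<bar>k\<bar>" "n - (n - nat \<bar>k\<bar>) = nat \<bar>k\<bar>" by auto
      then have "c (k + int n) = of_real (\<alpha> * (l ^ (n - nat \<bar>k\<bar>) + \<phi> * l ^ nat \<bar>k\<bar>))"
        by (simp only: c_def)
      also have "\<dots> = of_real \<phi> * c k"
        using \<phi> by (auto simp: c_def algebra_simps)
      finally show "c (k + int n) = of_real \<phi> * c k" .
    qed (simp add: c_def)
    then show ?thesis unfolding toep_def
    proof (rule witness)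
      show "(0::nat) < 1" "1 < n" using 2 by simp_all
      fix i j assume ij: "i < n" "j < n"
      define d where "d = nat \<bar>int i - int j\<bar>"
      have d: "d < n" using ij by (auto simp: d_def)
      have "l ^ (n - d) = l ^ n * inverse l ^ d"
        using 2 d by (simp add: power_diff divide_inverse power_inverse)
      then have "l ^ d - \<alpha> * (l ^ d + \<phi> * l ^ (n - d)) = (1 - \<alpha>) * l ^ d + \<kappa> * inverse l ^ d"
        by (simp add: \<kappa>_def algebra_simps)
      also have "\<dots> = \<kappa> * (l ^ d + inverse l ^ d)" by (simp add: \<alpha> algebra_simps)
      \<comment> \<open>The sum is even in \<open>i - j\<close>, so the absolute value drops out and
        the indices separate.\<close>
      also have "l ^ d + inverse l ^ d = l ^ i * inverse l ^ j + inverse l ^ i * l ^ j"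
      proof (cases "i \<le> j")
        case True
        then have "l ^ j = l ^ i * l ^ d" by (simp add: d_def nat_diff_distrib flip: power_add)
        then show ?thesis using 2 by (simp add: power_inverse field_simps)
      next
        case False
        then have "l ^ i = l ^ j * l ^ d" by (simp add: d_def nat_diff_distrib flip: power_add)
        then show ?thesis using 2 by (simp add: power_inverse field_simps)
      qed
      finally have "l ^ d - \<alpha> * (l ^ d + \<phi> * l ^ (n - d))
          = (\<kappa> * l ^ i) * inverse l ^ j + (\<kappa> * inverse l ^ i) * l ^ j" by (simp add: algebra_simps)
      then show "complex_of_real (l ^ nat \<bar>int i - int j\<bar>) - c (int i - int j)
          = of_real (\<kappa> * l ^ i) * of_real (inverse l ^ j) + of_real (\<kappa> * inverse l ^ i) * of_real (l ^ j)"
        unfolding c_def d_def[symmetric] of_real_diff[symmetric] of_real_mult[symmetric]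
          of_real_add[symmetric] by (simp only:)
    next
      \<comment> \<open>Both minors on the indices 0, 1 are nonzero multiples of
        \<open>l - inverse l\<close>.\<close>
      have "inverse l \<noteq> l"
      proof
        assume "inverse l = l"
        then have "l * l = 1" using 2 by (metis right_inverse)
        then show False using 2 by (metis abs_1 abs_minus_cancel square_eq_1_iff)
      qed
      then show "of_real (\<kappa> * l ^ 0) * of_real (\<kappa> * inverse l ^ 1)
          - complex_of_real (\<kappa> * l ^ 1) * of_real (\<kappa> * inverse l ^ 0) \<noteq> 0"
        "of_real (inverse l ^ 0) * of_real (l ^ 1)
          - complex_of_real (inverse l ^ 1) * of_real (l ^ 0) \<noteq> 0"
        using \<open>\<kappa> \<noteq> 0\<close> unfolding of_real_diff[symmetric] of_real_mult[symmetric] of_real_eq_0_iff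
        by (simp_all add: algebra_simps)
    qed
  next
    case 3
    obtain \<theta> :: real where \<theta>: "cos (n * \<theta>) = \<phi>" "sin (n * \<theta>) = 0" "sin \<theta> \<noteq> 0"
      using angle 3 by blast
    \<comment> \<open>The jump at 0 is harmless: for \<open>-n < k < 0\<close> neither
      \<open>k\<close> nor \<open>k + n\<close> is 0. The remainder
      \<open>cos ((i - j) * \<theta>)\<close> splits by the addition formula, and both minors on 0,
      1 equal \<open>sin \<theta>\<close>.\<close>
    define c :: "int \<Rightarrow> complex"
      where "c = (\<lambda>k. of_real ((if k = 0 then 1 else 0) - cos (of_int k * \<theta>)))"
    have "toep n c \<in> \<H>"
    proof (rule toep)
      fix k :: int assume k: "- int n < k" "k < 0"
      have "of_int (k + int n) * \<theta> = of_int k * \<theta> + n * \<theta>" by (simp add: algebra_simps)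
      then have "cos (of_int (k + int n) * \<theta>) = \<phi> * cos (of_int k * \<theta>)"
        by (simp only: cos_add \<theta>) simp
      then show "c (k + int n) = of_real \<phi> * c k" using k by (simp add: c_def)
    qed (simp add: c_def)
    then show ?thesis unfolding toep_def
    proof (rule witness)
      show "(0::nat) < 1" "1 < n" using 3 by simp_all
      fix i j assume "i < n" "j < n"
      have "of_int (int i - int j) * \<theta> = i * \<theta> - j * \<theta>" by (simp add: algebra_simps)
      then show "complex_of_real (l ^ nat \<bar>int i - int j\<bar>) - c (int i - int j)
          = of_real (cos (i * \<theta>)) * of_real (cos (j * \<theta>)) + of_real (sin (i * \<theta>)) * of_real (sin (j * \<theta>))"
        using 3 unfolding c_def by (simp only: cos_diff) (auto simp: power_0_left)
    qed (use \<theta> in simp_all)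
  next
    case 4
    obtain \<theta> :: real where \<theta>: "cos (n * \<theta>) = \<phi>" "sin \<theta> \<noteq> 0"
      using angle 4 by blast
    from rank_one[OF \<theta>(1)] obtain \<beta> where
      mem: "mat n n (\<lambda>(i, j). complex_of_real (2 * cos (real i * \<theta> - \<beta>) * cos (real j * \<theta> - \<beta>))) \<in> \<H>" ..
    define w where "w = (\<lambda>i::nat. cos (real i * \<theta> - \<beta>))"
    \<comment> \<open>The two minors are -2 and 1 times this expression; \<open>s < 3\<close> keeps
      the indices below \<open>n\<close>.\<close>
    obtain r s where rs: "r < s" "s < 3" "l ^ r * w s - l ^ s * w r \<noteq> 0"
      using cos_shift_not_proportional_to_power[OF 4(2) \<theta>(2)] unfolding w_def by blast
    from mem show ?thesis
    proof (rule witness)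
      show "r < s" "s < n" using rs 4 by simp_all
      fix i j assume "i < n" "j < n"
      have l2: "l * l = 1" using 4 by (metis abs_mult_self_eq mult_1)
      \<comment> \<open>Since \<open>l * l = 1\<close>, only the parity of the exponent counts, and
        \<open>i - j\<close> has that of \<open>i + j\<close>; K is an outer product.\<close>
      have "l ^ nat \<bar>int i - int j\<bar> = l ^ i * l ^ j"
      proof -
        have sq: "l ^ k * l ^ k = 1" for k using l2 by (metis power_mult_distrib power_one)
        show ?thesis
        proof (cases "i \<le> j")
          case True
          then have "l ^ j = l ^ i * l ^ nat \<bar>int i - int j\<bar>"
            by (simp add: nat_diff_distrib flip: power_add)
          then show ?thesis using sq[of i] by (simp add: mult.assoc[symmetric])
        next
          case False
          then have "l ^ i = l ^ nat \<bar>int i - int j\<bar> * l ^ j"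
            by (simp add: nat_diff_distrib flip: power_add)
          then show ?thesis using sq[of j] by (simp add: mult.assoc)
        qed
      qed
      then show "complex_of_real (l ^ nat \<bar>int i - int j\<bar>)
            - complex_of_real (2 * cos (real i * \<theta> - \<beta>) * cos (real j * \<theta> - \<beta>))
          = of_real (l ^ i) * of_real (l ^ j) + of_real (- 2 * w i) * of_real (w j)"
        by (simp add: w_def)
    next
      show "of_real (l ^ r) * of_real (- 2 * w s) - complex_of_real (l ^ s) * of_real (- 2 * w r) \<noteq> 0"
        "of_real (l ^ r) * of_real (w s) - complex_of_real (l ^ s) * of_real (w r) \<noteq> 0"
        using rs(3) unfolding of_real_diff[symmetric] of_real_mult[symmetric] of_real_eq_0_iff
        by (simp_all add: algebra_simps)
    qed
  qed
qed

end
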